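(* For every pair $\pi,\tau\in\mathcal{U}_n$, $\pi\le\tau$ in the weak order $\mathrm{Weak}(\mathcal{S}_n)$ if and only if (i) either $\pi,\tau\in\mathcal{L}_n$ or $\pi,\tau\in w_0\mathcal{L}_nw_0$, and (ii) $\mathrm{shape}(\pi)\subseteq\mathrm{shape}(\tau)$.
   Context: A permutation $\pi\in\mathcal{S}_n$ is left-unimodal if every prefix set $\{\pi(1),\dots,\pi(j)\}$, $1\le j\le n$, is an interval $\{a,a+1,\dots,b\}$ in $\mathbb{Z}$; it is unimodal if either it is left-unimodal or every suffix set $\{\pi(j),\dots,\pi(n)\}$, $1\le j\le n$, is an interval in $\mathbb{Z}$. $\mathcal{L}_n\subseteq\mathcal{U}_n$ denote the sets of left-unimodal and of unimodal permutations in $\mathcal{S}_n$. $w_0=n\cdots21$ is the longest permutation, and $w_0\mathcal{L}_nw_0=\{w_0\pi w_0:\pi\in\mathcal{L}_n\}$. Weak order: $\ell$ is the length function (number of inversions) of $\mathcal{S}_n$ with respect to the adjacent transpositions $\sigma_i=(i,i+1)$, $1\le i\le n-1$; $\mathrm{Weak}(\mathcal{S}_n)$ is the (right) weak order: $\pi\le\tau$ iff $\ell(\pi)+\ell(\pi^{-1}\tau)=\ell(\tau)$, where $\pi\tau$ denotes the composition $(\pi\tau)(x)=\pi(\tau(x))$ (so $\pi\sigma_i$ is $\pi$ with the letters in positions $i,i+1$ exchanged). Shape: the shifted staircase $\Delta_n$ is the set of boxes $(i,j)$, $1\le i<j\le n$ ($i$ the row, from top to bottom; $j$ the column, from left to right).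 A partial filling of $\Delta_n$ is obtained from a filling of $\Delta_n$ with $1,\dots,n(n-1)/2$, each used once, increasing along rows and columns, by erasing the numbers greater than $k$ for some $k$. If entry $r$ lies in box $(i,j)$, let $t_r$ be the transposition $(i,j)$; the permutation associated with the partial filling is the one sending $x$ to the result of applying $t_1$, then $t_2$, ..., then $t_k$ to $x$. The permutations so obtained are exactly those of $\mathcal{L}_n$, and all partial fillings giving the same $\pi\in\mathcal{L}_n$ have the same set of filled boxes; this set is $\mathrm{shape}(\pi)$. For $\pi\in\mathcal{U}_n\setminus\mathcal{L}_n$ one has $w_0\pi w_0\in\mathcal{L}_n$ and $\mathrm{shape}(\pi):=\mathrm{shape}(w_0\pi w_0)$. *)

theory Defs
  imports "HOL-Combinatorics.Permutations"
begin

(* A permutation in S_n is a function p with p permutes {1..n}; such a p fixes every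
   natural number outside {1..n}, so the product of permutations is \<circ> and the inverse is inv. *)

definition left_unimodal_perms :: "nat \<Rightarrow> (nat \<Rightarrow> nat) set" where
  "left_unimodal_perms n =
     {p. p permutes {1..n} \<and> (\<forall>j\<in>{1..n}. \<exists>a b. p ` {1..j} = {a..b})}"

definition unimodal_perms :: "nat \<Rightarrow> (nat \<Rightarrow> nat) set" where
  "unimodal_perms n =
     {p. p permutes {1..n} \<and>
         ((\<forall>j\<in>{1..n}. \<exists>a b. p ` {1..j} = {a..b}) \<or>
          (\<forall>j\<in>{1..n}. \<exists>a b. p ` {j..n} = {a..b}))}"

definition longest_perm :: "nat \<Rightarrow> nat \<Rightarrow> nat" where
  "longest_perm n = (\<lambda>x. if x \<in> {1..n} then n + 1 - x else x)"

definition conj_longest :: "nat \<Rightarrow> (nat \<Rightarrow> nat) \<Rightarrow> (nat \<Rightarrow> nat)" where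
  "conj_longest n p = longest_perm n \<circ> p \<circ> longest_perm n"

definition perm_length :: "nat \<Rightarrow> (nat \<Rightarrow> nat) \<Rightarrow> nat" where
  "perm_length n p = card {(i, j). 1 \<le> i \<and> i < j \<and> j \<le> n \<and> p j < p i}"

definition weak_le :: "nat \<Rightarrow> (nat \<Rightarrow> nat) \<Rightarrow> (nat \<Rightarrow> nat) \<Rightarrow> bool" where
  "weak_le n p q \<longleftrightarrow> perm_length n p + perm_length n (inv p \<circ> q) = perm_length n q"

definition shifted_staircase :: "nat \<Rightarrow> (nat \<times> nat) set" where
  "shifted_staircase n = {(i, j). 1 \<le> i \<and> i < j \<and> j \<le> n}"

definition standard_filling :: "nat \<Rightarrow> (nat \<times> nat \<Rightarrow> nat) \<Rightarrow> bool" where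
  "standard_filling n T \<longleftrightarrow>
     bij_betw T (shifted_staircase n) {1..n * (n - 1) div 2} \<and>
     (\<forall>i j j'. (i, j) \<in> shifted_staircase n \<and> (i, j') \<in> shifted_staircase n \<and> j < j'
        \<longrightarrow> T (i, j) < T (i, j')) \<and>
     (\<forall>i i' j. (i, j) \<in> shifted_staircase n \<and> (i', j) \<in> shifted_staircase n \<and> i < i'
        \<longrightarrow> T (i, j) < T (i', j))"

(* A partial filling is a partial map on boxes whose domain is the set of filled boxes. *)

definition partial_filling :: "nat \<Rightarrow> (nat \<times> nat \<Rightarrow> nat option) \<Rightarrow> bool" where
  "partial_filling n F \<longleftrightarrow>
     (\<exists>T k. standard_filling n T \<and>
        F = (\<lambda>b. if b \<in> shifted_staircase n \<and> T b \<le> k then Some (T b) else None))"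

definition entry_transposition :: "(nat \<times> nat \<Rightarrow> nat option) \<Rightarrow> nat \<Rightarrow> (nat \<Rightarrow> nat)" where
  "entry_transposition F r = (case (THE b. F b = Some r) of (i, j) \<Rightarrow> transpose i j)"

(* The entries of a partial filling F are 1, ..., k with k = card (dom F), and the value
   below is t_k \<circ> ... \<circ> t_1, i.e. t_1 is applied first. *)

definition filling_perm :: "(nat \<times> nat \<Rightarrow> nat option) \<Rightarrow> (nat \<Rightarrow> nat)" where
  "filling_perm F = fold (\<lambda>r p. entry_transposition F r \<circ> p) [1..<Suc (card (dom F))] id"

(* The description is meaningful on left_unimodal_perms n: there a partial filling with
   permutation p exists, and all of them have the same set of filled boxes. *)

definition left_shape :: "nat \<Rightarrow> (nat \<Rightarrow> nat) \<Rightarrow> (nat \<times> nat) set" where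
  "left_shape n p = (THE S. \<exists>F. partial_filling n F \<and> filling_perm F = p \<and> S = dom F)"

definition shape :: "nat \<Rightarrow> (nat \<Rightarrow> nat) \<Rightarrow> (nat \<times> nat) set" where
  "shape n p =
     (if p \<in> left_unimodal_perms n then left_shape n p else left_shape n (conj_longest n p))"

end

(* Let V(p) be the set of pairs a < b of letters such that b precedes a in the word of p. Since
   the length of inv p \<circ> q is the size of the symmetric difference of V(p) and V(q), the weak order
   is inclusion of the sets V. If p is left-unimodal, then V(p) is an order ideal of the shifted
   staircase, and V(p) is literally the shape of p: adding the box (i, j) to a partial filling
   exchanges two adjacent letters i < j. Conjugation by the longest permutation reflects V(p) in
   the antidiagonal of the staircase, which settles pairs on the same side. For pairs on different
   sides, an inclusion forces one of the two ideals to be empty or everything, hence one of the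
   permutations to be invariant under the conjugation. *)
theory Submission
  imports Defs
begin

section \<open>Inversion sets and order ideals of the staircase\<close>

text \<open>Here \<open>inv p a\<close> is the position of the letter \<open>a\<close>. Indexing
  inversions by letters instead of positions places them in the same set of pairs as the boxes of
  the staircase.\<close>

definition value_inversions :: "nat \<Rightarrow> (nat \<Rightarrow> nat) \<Rightarrow> (nat \<times> nat) set" where
  "value_inversions n p = {(a, b). 1 \<le> a \<and> a < b \<and> b \<le> n \<and> inv p b < inv p a}"

text \<open>Order ideals for the componentwise order on boxes, i.e. shifted diagrams of strict
  partitions with all parts less than \<open>n\<close>.\<close>

definition staircase_ideal :: "nat \<Rightarrow> (nat \<times> nat) set \<Rightarrow> bool" where
  "staircase_ideal n S \<longleftrightarrow> S \<subseteq> shifted_staircase n \<and>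
     (\<forall>i j i' j'. (i, j) \<in> S \<and> (i', j') \<in> shifted_staircase n \<and> i' \<le> i \<and> j' \<le> j
        \<longrightarrow> (i', j') \<in> S)"

lemma mem_value_inversions:
  "(a, b) \<in> value_inversions n p \<longleftrightarrow> 1 \<le> a \<and> a < b \<and> b \<le> n \<and> inv p b < inv p a"
  by (simp add: value_inversions_def)

lemma mem_shifted_staircase: "(i, j) \<in> shifted_staircase n \<longleftrightarrow> 1 \<le> i \<and> i < j \<and> j \<le> n"
  by (simp add: shifted_staircase_def)

lemma staircase_idealD:
  assumes "staircase_ideal n S" and "(i, j) \<in> S"
    and "1 \<le> i'" and "i' < j'" and "i' \<le> i" and "j' \<le> j"
  shows "(i', j') \<in> S"
proof -
  have "j \<le> n" using assms unfolding staircase_ideal_def shifted_staircase_def by blast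
  then have "(i', j') \<in> shifted_staircase n" using assms by (simp add: mem_shifted_staircase)
  then show ?thesis using assms unfolding staircase_ideal_def by blast
qed

lemma finite_shifted_staircase: "finite (shifted_staircase n)"
  by (rule finite_subset[of _ "{1..n} \<times> {1..n}"]) (auto simp: shifted_staircase_def)

lemma card_shifted_staircase: "card (shifted_staircase n) = n * (n - 1) div 2"
proof -
  \<comment> \<open>Counting by columns: column j has j - 1 boxes, and the index 0 contributes the
    empty set.\<close>
  have "card (shifted_staircase n) = card (Sigma {..<n} (\<lambda>j. {1..j}))"
    by (rule bij_betw_same_card[of "\<lambda>(i, j). (j - 1, i)"], rule bij_betw_byWitness[where f' = "\<lambda>(j, i). (i, Suc j)"])
       (auto simp: shifted_staircase_def)
  also have "\<dots> = (\<Sum>j<n. j)"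
    by (subst card_SigmaI) auto
  also have "\<dots> = n * (n - 1) div 2"
    by (simp add: Sum_Ico_nat lessThan_atLeast0)
  finally show ?thesis .
qed

lemma value_inversions_subset: "value_inversions n p \<subseteq> shifted_staircase n"
  by (auto simp: value_inversions_def shifted_staircase_def)

lemma finite_value_inversions: "finite (value_inversions n p)"
  using finite_subset[OF value_inversions_subset finite_shifted_staircase] .

section \<open>Weak order as inclusion of inversion sets\<close>

text \<open>Positions i < j form an inversion of \<open>inv p \<circ> q\<close> exactly when the
  letters \<open>q i\<close> and \<open>q j\<close> come in opposite orders in the words of
  \<open>p\<close> and \<open>q\<close>. The map \<open>?f\<close> sends the positions to the sorted
  pair of letters, and \<open>?g\<close> sends a pair of letters back to its sorted positions in
  \<open>q\<close>.\<close>

lemma perm_length_inv_comp: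
  assumes p: "p permutes {1..n}" and q: "q permutes {1..n}"
  shows "perm_length n (inv p \<circ> q) =
    card ((value_inversions n p - value_inversions n q) \<union> (value_inversions n q - value_inversions n p))"
proof -
  let ?f = "\<lambda>(i, j). (min (q i) (q j), max (q i) (q j))"
  let ?g = "\<lambda>(a, b). (min (inv q a) (inv q b), max (inv q a) (inv q b))"
  have inv_q: "inv q permutes {1..n}" using permutes_inv[OF q] .
  have [simp]: "inv q (q x) = x" "q (inv q x) = x" for x
    using permutes_inverses[OF q] by auto
  have rq: "1 \<le> q x \<and> q x \<le> n \<longleftrightarrow> 1 \<le> x \<and> x \<le> n" for x
    using permutes_in_image[OF q, of x] by auto
  have riq: "1 \<le> inv q x \<and> inv q x \<le> n \<longleftrightarrow> 1 \<le> x \<and> x \<le> n" for x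
    using permutes_in_image[OF inv_q, of x] by auto
  have inj: "inv p x = inv p y \<longleftrightarrow> x = y" "q x = q y \<longleftrightarrow> x = y" "inv q x = inv q y \<longleftrightarrow> x = y" for x y
    using permutes_inj[OF permutes_inv[OF p]] permutes_inj[OF q] permutes_inj[OF inv_q]
    by (auto dest: injD)
  have "bij_betw ?f {(i, j). 1 \<le> i \<and> i < j \<and> j \<le> n \<and> (inv p \<circ> q) j < (inv p \<circ> q) i}
     ((value_inversions n p - value_inversions n q) \<union> (value_inversions n q - value_inversions n p))"
  proof (rule bij_betw_byWitness[where f' = ?g], goal_cases)
    case 1
    show ?case by (auto simp: min_def max_def)
  next
    case 2
    have "?f (?g (a, b)) = (a, b)" if "a < b" for a b :: nat
      using that by (cases "inv q a \<le> inv q b") (auto simp: min_def max_def)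
    then show ?case by (auto simp: value_inversions_def simp del: split_paired_All)
  next
    case 3
    have "?f (i, j) \<in> (value_inversions n p - value_inversions n q) \<union> (value_inversions n q - value_inversions n p)"
      if h: "1 \<le> i" "i < j" "j \<le> n" "inv p (q j) < inv p (q i)" for i j
    proof -
      have "q i \<noteq> q j" using h inj by auto
      then show ?thesis using h rq[of i] rq[of j]
        by (cases "q i < q j") (auto simp: value_inversions_def min_def max_def)
    qed
    then show ?case by auto
  next
    case 4
    have image_claim: "?g (a, b) \<in> {(i, j). 1 \<le> i \<and> i < j \<and> j \<le> n \<and> (inv p \<circ> q) j < (inv p \<circ> q) i}"
      if h: "(a, b) \<in> (value_inversions n p - value_inversions n q) \<union> (value_inversions n q - value_inversions n p)" for a b
    proof -
      have ab: "1 \<le> a" "a < b" "b \<le> n" using h by (auto simp: value_inversions_def)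
      then have "inv q a \<noteq> inv q b" "inv p a \<noteq> inv p b" using inj by auto
      then show ?thesis using h riq[of a] riq[of b] ab
        by (cases "inv q a < inv q b") (auto simp: value_inversions_def min_def max_def)
    qed
    show ?case
    proof (rule image_subsetI)
      fix x assume x: "x \<in> (value_inversions n p - value_inversions n q) \<union> (value_inversions n q - value_inversions n p)"
      obtain a b where "x = (a, b)" by (rule prod.exhaust)
      then show "?g x \<in> {(i, j). 1 \<le> i \<and> i < j \<and> j \<le> n \<and> (inv p \<circ> q) j < (inv p \<circ> q) i}"
        using image_claim[of a b] x by (simp only:)
    qed
  qed
  then show ?thesis unfolding perm_length_def by (rule bij_betw_same_card)
qed

lemma perm_length_eq_card_value_inversions:
  assumes "p permutes {1..n}"
  shows "perm_length n p = card (value_inversions n p)"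
proof -
  have "value_inversions n id = {}" by (auto simp: value_inversions_def)
  then show ?thesis
    using perm_length_inv_comp[OF permutes_id assms] by simp
qed

lemma weak_le_iff_value_inversions:
  assumes p: "p permutes {1..n}" and q: "q permutes {1..n}"
  shows "weak_le n p q \<longleftrightarrow> value_inversions n p \<subseteq> value_inversions n q"
proof -
  let ?P = "value_inversions n p" and ?Q = "value_inversions n q"
  have fin: "finite ?P" "finite ?Q" by (rule finite_value_inversions)+
  have "card ((?P - ?Q) \<union> (?Q - ?P)) = card (?P - ?Q) + card (?Q - ?P)"
    by (rule card_Un_disjoint) (use fin in auto)
  moreover have "card ?P = card (?P \<inter> ?Q) + card (?P - ?Q)" "card ?Q = card (?P \<inter> ?Q) + card (?Q - ?P)"
    using fin card_Int_Diff[of ?P ?Q] card_Int_Diff[of ?Q ?P] by (simp_all add: Int_commute)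
  \<comment> \<open>Substituting the three counts into the length equation and cancelling leaves
    twice \<open>card (?P - ?Q)\<close> equal to 0.\<close>
  ultimately have "weak_le n p q \<longleftrightarrow> card (?P - ?Q) = 0"
    unfolding weak_le_def perm_length_inv_comp[OF p q] perm_length_eq_card_value_inversions[OF p]
      perm_length_eq_card_value_inversions[OF q] by auto
  then show ?thesis using fin by auto
qed

text \<open>The position of a letter is the number of letters standing at or before it, and the
  inversion set decides for any two letters which one comes first.\<close>

lemma value_inversions_inject:
  assumes p: "p permutes {1..n}" and q: "q permutes {1..n}"
    and eq: "value_inversions n p = value_inversions n q"
  shows "p = q"
proof -
  have rank: "inv r x = card {y \<in> {1..n}. inv r y \<le> inv r x}" if r: "r permutes {1..n}" and x: "x \<in> {1..n}" for r x
  proof -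
    have r': "inv r permutes {1..n}" using permutes_inv[OF r] .
    have "inv r ` {y \<in> {1..n}. inv r y \<le> inv r x} = {1..inv r x}" (is "_ ` ?A = _")
    proof
      show "inv r ` ?A \<subseteq> {1..inv r x}"
        using permutes_in_image[OF r'] by fastforce
      show "{1..inv r x} \<subseteq> inv r ` ?A"
      proof
        fix z assume z: "z \<in> {1..inv r x}"
        moreover have "inv r x \<le> n" using permutes_in_image[OF r', of x] x by auto
        ultimately have "r z \<in> {1..n}" using permutes_in_image[OF r, of z] by auto
        moreover have "inv r (r z) = z" using permutes_inverses[OF r] by auto
        ultimately show "z \<in> inv r ` ?A" using z by (intro image_eqI[of _ _ "r z"]) auto
      qed
    qed
    moreover have "card (inv r ` ?A) = card ?A"
      using permutes_inj[OF r'] by (intro card_image) (auto intro: inj_on_subset)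
    ultimately show ?thesis by simp
  qed
  have le: "inv r y \<le> inv r x \<longleftrightarrow> (if y < x then (y, x) \<notin> value_inversions n r else x = y \<or> (x, y) \<in> value_inversions n r)"
    if r: "r permutes {1..n}" and x: "x \<in> {1..n}" "y \<in> {1..n}" for r x y
  proof -
    have "inv r x = inv r y \<longleftrightarrow> x = y" using permutes_inj[OF permutes_inv[OF r]] by (auto dest: injD)
    then show ?thesis using x by (auto simp: mem_value_inversions)
  qed
  have "inv p x = inv q x" for x
  proof (cases "x \<in> {1..n}")
    case True
    have "{y \<in> {1..n}. inv p y \<le> inv p x} = {y \<in> {1..n}. inv q y \<le> inv q x}"
      using le[OF p True] le[OF q True] eq by auto
    then show ?thesis using rank[OF p True] rank[OF q True] by simp
  next
    case False
    then show ?thesis using permutes_inv[OF p] permutes_inv[OF q] by (auto simp: permutes_def)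
  qed
  then have "inv p = inv q" by (rule ext)
  then show ?thesis using permutes_inv_inv[OF p] permutes_inv_inv[OF q] by metis
qed

(* The ideal property forces the letters i and j to occupy adjacent positions of p, so exchanging
   them affects no other inversion. *)
lemma value_inversions_transpose:
  assumes p: "p permutes {1..n}"
    and ideal: "staircase_ideal n (value_inversions n p)"
    and ideal': "staircase_ideal n (insert (i, j) (value_inversions n p))"
    and new: "(i, j) \<notin> value_inversions n p"
  shows "value_inversions n (transpose i j \<circ> p) = insert (i, j) (value_inversions n p)"
proof -
  let ?S = "value_inversions n p"
  have ij: "1 \<le> i" "i < j" "j \<le> n"
    using ideal' by (auto simp: staircase_ideal_def mem_shifted_staircase)
  have inj: "inv p x = inv p y \<longleftrightarrow> x = y" for x y
    using permutes_inj[OF permutes_inv[OF p]] by (auto dest: injD)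
  have pos: "inv p i < inv p j"
    using new ij inj[of i j] by (auto simp: mem_value_inversions)
  have adj: False if v: "1 \<le> v" "v \<le> n" and b: "inv p i < inv p v" "inv p v < inv p j" for v
  proof -
    have vne: "v \<noteq> i" "v \<noteq> j" using b by auto
    \<comment> \<open>A letter v standing between i and j is impossible. If v < j, then (v, j) or
      (i, v) lies below the new box in the enlarged ideal, and that inversion contradicts the
      position of v. If v > j, then (j, v) is already an inversion, and the old ideal would contain
      (i, j).\<close>
    consider "v < i" | "i < v" "v < j" | "j < v" using vne by linarith
    then show False
    proof cases
      case 1
      then have "(v, j) \<in> ?S"
        using staircase_idealD[OF ideal', of i j v j] ij v by simp
      then show False using b by (auto simp: mem_value_inversions)
    next
      case 2
      then have "(i, v) \<in> ?S"
        using staircase_idealD[OF ideal', of i j i v] ij v by simp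
      then show False using b by (auto simp: mem_value_inversions)
    next
      case 3
      then have "(j, v) \<in> ?S" using b v ij by (auto simp: mem_value_inversions)
      then have "(i, j) \<in> ?S" using staircase_idealD[OF ideal, of j v i j] ij 3 by simp
      then show False using new by simp
    qed
  qed
  have inv: "inv (transpose i j \<circ> p) x = inv p (transpose i j x)" for x
  proof -
    have "inv (transpose i j \<circ> p) = inv p \<circ> transpose i j"
      by (subst o_inv_distrib) (use permutes_bij[OF p] in auto)
    then show ?thesis by simp
  qed
  have outside: "inv p v < inv p i \<longleftrightarrow> inv p v < inv p j" "inv p i < inv p v \<longleftrightarrow> inv p j < inv p v"
    if "1 \<le> v" "v \<le> n" "v \<noteq> i" "v \<noteq> j" for v
    using adj[OF that(1,2)] pos inj[of v i] inj[of v j] that by (meson less_trans linorder_neqE_nat)+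
  have "(a, b) \<in> value_inversions n (transpose i j \<circ> p) \<longleftrightarrow> (a, b) \<in> insert (i, j) ?S" for a b
  proof (cases "1 \<le> a \<and> a < b \<and> b \<le> n")
    case True
    then show ?thesis using outside[of a] outside[of b] pos ij
      by (auto simp: mem_value_inversions inv transpose_def)
  next
    case False
    then show ?thesis using ij by (auto simp: mem_value_inversions)
  qed
  then show ?thesis by auto
qed

section \<open>Partial fillings and order ideals\<close>

lemma staircase_ideal_initial_entries:
  assumes "standard_filling n T"
  shows "staircase_ideal n {b \<in> shifted_staircase n. T b \<le> m}"
proof -
  have mono: "T (i', j') \<le> T (i, j)"
    if h: "(i, j) \<in> shifted_staircase n" "(i', j') \<in> shifted_staircase n" "i' \<le> i" "j' \<le> j" for i j i' j'
  proof -
    \<comment> \<open>The comparison goes through the box (i', j), which lies in the staircase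
      because i' \<le> i < j; the other corner (i, j') may fall outside it.\<close>
    have mid: "(i', j) \<in> shifted_staircase n" using h by (auto simp: mem_shifted_staircase)
    have "T (i', j') \<le> T (i', j)"
      using assms h mid unfolding standard_filling_def by (cases "j' = j") (auto intro!: less_imp_le)
    also have "\<dots> \<le> T (i, j)"
      using assms h mid unfolding standard_filling_def by (cases "i' = i") (auto intro!: less_imp_le)
    finally show ?thesis .
  qed
  show ?thesis
    unfolding staircase_ideal_def
  proof (intro conjI allI impI)
    fix i j i' j'
    assume h: "(i, j) \<in> {b \<in> shifted_staircase n. T b \<le> m} \<and> (i', j') \<in> shifted_staircase n \<and> i' \<le> i \<and> j' \<le> j"
    then have "T (i', j') \<le> T (i, j)" by (intro mono) auto
    then show "(i', j') \<in> {b \<in> shifted_staircase n. T b \<le> m}" using h by auto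
  qed auto
qed

text \<open>Induction on the number m of entries applied: the boxes with entries up to m and up to m
  + 1 are both ideals, so \<open>value_inversions_transpose\<close> shows that each transposition
  adds precisely its own box to the inversion set.\<close>

lemma partial_filling_perm:
  assumes "partial_filling n F"
  shows "filling_perm F permutes {1..n}" and "value_inversions n (filling_perm F) = dom F"
proof -
  obtain T k where T: "standard_filling n T"
    and F: "F = (\<lambda>b. if b \<in> shifted_staircase n \<and> T b \<le> k then Some (T b) else None)"
    using assms unfolding partial_filling_def by blast
  let ?D = "shifted_staircase n" and ?N = "n * (n - 1) div 2"
  let ?S = "\<lambda>m. {b \<in> ?D. T b \<le> m}"
  let ?q = "\<lambda>m. fold (\<lambda>r p. entry_transposition F r \<circ> p) [1..<Suc m] id"
  have bij: "bij_betw T ?D {1..?N}" using T by (simp add: standard_filling_def)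
  have domF: "dom F = ?S k" by (auto simp: F dom_def)
  \<comment> \<open>The cutoff k may exceed the number of boxes, hence the minimum.\<close>
  have "T ` ?S k = {1..min k ?N}"
  proof -
    have "T ` ?S k = T ` ?D \<inter> {..k}" by auto
    also have "\<dots> = {1..min k ?N}" using bij by (auto simp: bij_betw_def)
    finally show ?thesis .
  qed
  moreover have "inj_on T (?S k)" using bij by (auto simp: bij_betw_def intro: inj_on_subset)
  ultimately have cardD: "card (dom F) = min k ?N" unfolding domF by (metis card_atLeastAtMost card_image diff_Suc_1)
  have main: "?q m permutes {1..n} \<and> value_inversions n (?q m) = ?S m" if "m \<le> min k ?N" for m
    using that
  proof (induction m)
    case 0
    have "T b \<noteq> 0" if "b \<in> ?D" for b using bij that by (fastforce simp: bij_betw_def)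
    then have "?S 0 = {}" by auto
    moreover have "value_inversions n id = {}" by (auto simp: value_inversions_def)
    moreover have "?q 0 = id" by (simp add: fun_eq_iff)
    ultimately show ?case by (simp only: permutes_id simp_thms)
  next
    case (Suc m)
    have IH: "?q m permutes {1..n}" "value_inversions n (?q m) = ?S m"
      using Suc.IH[OF Suc_leD[OF Suc.prems]] by blast+
    have "Suc m \<in> T ` ?D" using bij Suc.prems by (auto simp: bij_betw_def)
    then obtain i j where ij: "(i, j) \<in> ?D" "T (i, j) = Suc m" by (metis imageE surj_pair)
    have uniq: "b = (i, j)" if "b \<in> ?D" "T b = Suc m" for b
      using bij that ij unfolding bij_betw_def inj_on_def by metis
    have "(THE b. F b = Some (Suc m)) = (i, j)"
    proof (rule the_equality)
      show "F (i, j) = Some (Suc m)" using ij Suc.prems by (simp add: F)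
      show "b = (i, j)" if "F b = Some (Suc m)" for b
        using that by (intro uniq) (simp_all add: F split: if_splits)
    qed
    then have "entry_transposition F (Suc m) = transpose i j"
      by (simp add: entry_transposition_def)
    then have step: "?q (Suc m) = transpose i j \<circ> ?q m" by simp
    have S: "?S (Suc m) = insert (i, j) (?S m)" using ij by (auto simp: le_Suc_eq dest: uniq)
    have "value_inversions n (transpose i j \<circ> ?q m) = insert (i, j) (value_inversions n (?q m))"
    proof (rule value_inversions_transpose[OF IH(1)])
      show "staircase_ideal n (value_inversions n (?q m))"
        unfolding IH(2) by (rule staircase_ideal_initial_entries[OF T])
      show "staircase_ideal n (insert (i, j) (value_inversions n (?q m)))"
        unfolding IH(2) S[symmetric] by (rule staircase_ideal_initial_entries[OF T])
      show "(i, j) \<notin> value_inversions n (?q m)" unfolding IH(2) using ij by simp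
    qed
    moreover have "transpose i j permutes {1..n}"
      using ij by (intro permutes_swap_id) (auto simp: mem_shifted_staircase)
    ultimately show ?case unfolding step S IH(2) using permutes_compose[OF IH(1)] by blast
  qed
  have "T b \<le> ?N" if "b \<in> ?D" for b using bij_betw_apply[OF bij that] by simp
  then have "?S (min k ?N) = ?S k" by (simp cong: conj_cong)
  then show "filling_perm F permutes {1..n}" "value_inversions n (filling_perm F) = dom F"
    using main[OF order_refl] domF unfolding filling_perm_def cardD by (simp_all only:)
qed

(* A linear extension listing S first: rank the boxes by the key (b \<notin> S, row, column). *)
lemma ex_partial_filling_dom:
  assumes S: "staircase_ideal n S"
  shows "\<exists>F. partial_filling n F \<and> dom F = S"
proof -
  let ?D = "shifted_staircase n" and ?N = "n * (n - 1) div 2"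
  define lt where "lt = (\<lambda>(i, j) (i', j'). 
     (i, j) \<in> S \<and> (i', j') \<notin> S \<or> ((i, j) \<in> S \<longleftrightarrow> (i', j') \<in> S) \<and> (i < i' \<or> i = i' \<and> j < (j' :: nat)))"
  have irrefl: "\<not> lt b b" for b by (auto simp: lt_def)
  have trans: "lt a b \<Longrightarrow> lt b c \<Longrightarrow> lt a c" for a b c by (auto simp: lt_def)
  have total: "lt a b \<or> a = b \<or> lt b a" for a b by (auto simp: lt_def)
  define T where "T = (\<lambda>b. Suc (card {a \<in> ?D. lt a b}))"
  note fin = finite_shifted_staircase[of n]
  have mono: "T a < T b" if "a \<in> ?D" "lt a b" for a b
  proof -
    have "{c \<in> ?D. lt c a} \<subset> {c \<in> ?D. lt c b}" using that trans irrefl by blast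
    then show ?thesis unfolding T_def using fin by (simp add: psubset_card_mono)
  qed
  have inj: "inj_on T ?D" using mono total by (metis inj_onI less_irrefl)
  have "T b \<in> {1..?N}" if "b \<in> ?D" for b
  proof -
    have "{a \<in> ?D. lt a b} \<subset> ?D" using that irrefl by blast
    then have "card {a \<in> ?D. lt a b} < card ?D" using fin by (simp add: psubset_card_mono)
    then show ?thesis by (simp add: T_def card_shifted_staircase)
  qed
  then have "T ` ?D = {1..?N}"
    using card_image[OF inj] by (intro card_subset_eq) (auto simp: card_shifted_staircase)
  then have bij: "bij_betw T ?D {1..?N}" using inj by (simp add: bij_betw_def)
  \<comment> \<open>Listing S first could reverse a row or a column only if S contained the later
    box without the earlier one, which the ideal property excludes.\<close>
  have "T (i, j) < T (i, j')" if "(i, j) \<in> ?D" "(i, j') \<in> ?D" "j < j'" for i j j'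
  proof -
    have "(i, j') \<in> S \<Longrightarrow> (i, j) \<in> S"
      using staircase_idealD[OF S, of i j' i j] that by (simp add: mem_shifted_staircase)
    then have "lt (i, j) (i, j')" using that by (auto simp: lt_def)
    then show ?thesis using mono that by blast
  qed
  moreover have "T (i, j) < T (i', j)" if "(i, j) \<in> ?D" "(i', j) \<in> ?D" "i < i'" for i i' j
  proof -
    have "(i', j) \<in> S \<Longrightarrow> (i, j) \<in> S"
      using staircase_idealD[OF S, of i' j i j] that by (simp add: mem_shifted_staircase)
    then have "lt (i, j) (i', j)" using that by (auto simp: lt_def)
    then show ?thesis using mono that by blast
  qed
  ultimately have "standard_filling n T" using bij unfolding standard_filling_def by blast
  then have "partial_filling n (\<lambda>b. if b \<in> ?D \<and> T b \<le> card S then Some (T b) else None)"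
    unfolding partial_filling_def by blast
  \<comment> \<open>Boxes of S precede all others, so a box of S has fewer than
    \<open>card S\<close> predecessors, while a box outside S has all of S before it. The cutoff
    \<open>card S\<close> therefore keeps S exactly.\<close>
  moreover have "T b \<le> card S \<longleftrightarrow> b \<in> S" if b: "b \<in> ?D" for b
  proof
    assume "b \<in> S"
    then have "{a \<in> ?D. lt a b} \<subseteq> S" by (auto simp: lt_def)
    then have "{a \<in> ?D. lt a b} \<subset> S" using irrefl[of b] \<open>b \<in> S\<close> by blast
    moreover have "finite S" using S fin finite_subset unfolding staircase_ideal_def by blast
    ultimately show "T b \<le> card S" by (simp add: T_def Suc_le_eq psubset_card_mono)
  next
    assume *: "T b \<le> card S"
    show "b \<in> S"
    proof (rule ccontr)
      assume "b \<notin> S"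
      then have "S \<subseteq> {a \<in> ?D. lt a b}"
        using S unfolding staircase_ideal_def by (auto simp: lt_def)
      then have "card S \<le> card {a \<in> ?D. lt a b}" using fin by (intro card_mono) auto
      then show False using * by (simp add: T_def)
    qed
  qed
  then have "dom (\<lambda>b. if b \<in> ?D \<and> T b \<le> card S then Some (T b) else None) = S"
    using S by (auto simp: dom_def staircase_ideal_def)
  ultimately show ?thesis by blast
qed

section \<open>Shapes of left-unimodal permutations\<close>

lemma left_unimodal_permutes: "p \<in> left_unimodal_perms n \<Longrightarrow> p permutes {1..n}"
  by (simp add: left_unimodal_perms_def)

text \<open>Since prefixes are intervals, a letter lying in value between two letters of a prefix
  belongs to that prefix (\<open>between\<close>). A box is moved first within its column and then
  within its row.\<close>

lemma staircase_ideal_value_inversions: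
  assumes "p \<in> left_unimodal_perms n"
  shows "staircase_ideal n (value_inversions n p)"
proof -
  have p: "p permutes {1..n}" using assms by (rule left_unimodal_permutes)
  have p': "inv p permutes {1..n}" using permutes_inv[OF p] .
  have inj: "inv p x = inv p y \<longleftrightarrow> x = y" for x y
    using permutes_inj[OF p'] by (auto dest: injD)
  have between: "inv p y \<le> inv p u"
    if h: "x \<in> {1..n}" "y \<in> {1..n}" "z \<in> {1..n}" "u \<in> {1..n}" "x < y" "y < z"
      "inv p x \<le> inv p u" "inv p z \<le> inv p u" for x y z u
  proof -
    have j: "inv p v \<in> {1..n}" if "v \<in> {1..n}" for v using permutes_in_image[OF p'] that by blast
    then obtain a b where ab: "p ` {1..inv p u} = {a..b}"
      using assms h(4) unfolding left_unimodal_perms_def by blast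
    have mem: "v \<in> p ` {1..inv p u} \<longleftrightarrow> inv p v \<le> inv p u" if "v \<in> {1..n}" for v
    proof
      assume "v \<in> p ` {1..inv p u}"
      then show "inv p v \<le> inv p u" using permutes_inverses[OF p] by auto
    next
      assume "inv p v \<le> inv p u"
      then show "v \<in> p ` {1..inv p u}" using j[OF that] permutes_inverses[OF p]
        by (intro image_eqI[of _ _ "inv p v"]) auto
    qed
    then have "x \<in> {a..b}" "z \<in> {a..b}" using h ab by auto
    then have "y \<in> {a..b}" using h by auto
    then show ?thesis using mem[of y] h ab by auto
  qed
  have "(i', j') \<in> value_inversions n p"
    if ij: "(i, j) \<in> value_inversions n p" and D: "(i', j') \<in> shifted_staircase n" and le: "i' \<le> i" "j' \<le> j"
    for i j i' j'
  proof -
    have h: "1 \<le> i" "i < j" "j \<le> n" "inv p j < inv p i" "1 \<le> i'" "i' < j'" "j' \<le> n"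
      using ij D by (auto simp: mem_value_inversions mem_shifted_staircase)
    \<comment> \<open>If i' came no later than j, the prefix ending at j would contain i' and j,
      hence also i, although j precedes i.\<close>
    have col: "inv p j < inv p i'"
    proof (rule ccontr)
      assume "\<not> ?thesis"
      then show False using between[of i' i j j] h le by (cases "i' = i") auto
    qed
    have "inv p j' < inv p i'"
    proof (cases "j' = j")
      case False
      \<comment> \<open>The prefix ending at i' contains i' and j, hence j'.\<close>
      then have "inv p j' \<le> inv p i'" using between[of i' j' j i'] h le col by auto
      then show ?thesis using inj[of i' j'] h by auto
    qed (use col in simp)
    then show ?thesis using h by (simp add: mem_value_inversions)
  qed
  then show ?thesis unfolding staircase_ideal_def using value_inversions_subset by blast
qed

text \<open>This justifies the definite description. A filling of the ideal exists, and its
  permutation is \<open>p\<close> because inversion sets determine permutations; every other filling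
  with permutation \<open>p\<close> has the same inversion set as its domain.\<close>

lemma left_shape_eq:
  assumes "p \<in> left_unimodal_perms n"
  shows "left_shape n p = value_inversions n p"
proof -
  obtain F where F: "partial_filling n F" "dom F = value_inversions n p"
    using ex_partial_filling_dom[OF staircase_ideal_value_inversions[OF assms]] by blast
  have "filling_perm F = p"
    using value_inversions_inject[OF partial_filling_perm(1)[OF F(1)] left_unimodal_permutes[OF assms]]
      partial_filling_perm(2)[OF F(1)] F(2) by simp
  show ?thesis unfolding left_shape_def
  proof (rule the_equality)
    show "\<exists>F. partial_filling n F \<and> filling_perm F = p \<and> value_inversions n p = dom F"
      using F \<open>filling_perm F = p\<close> by metis
    fix S assume "\<exists>F. partial_filling n F \<and> filling_perm F = p \<and> S = dom F"
    then show "S = value_inversions n p" using partial_filling_perm(2) by metis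
  qed
qed

section \<open>Conjugation by the longest permutation\<close>

lemma longest_perm_permutes: "longest_perm n permutes {1..n}"
  by (rule bij_imp_permutes, rule bij_betw_byWitness[where f' = "longest_perm n"]) (auto simp: longest_perm_def)

lemma longest_perm_involution [simp]: "longest_perm n (longest_perm n x) = x"
  by (auto simp: longest_perm_def)

lemma conj_longest_involution [simp]: "conj_longest n (conj_longest n p) = p"
  by (auto simp: conj_longest_def)

lemma conj_longest_permutes: "p permutes {1..n} \<Longrightarrow> conj_longest n p permutes {1..n}"
  unfolding conj_longest_def by (intro permutes_compose longest_perm_permutes)

lemma mem_conj_longest_image: "p \<in> conj_longest n ` A \<longleftrightarrow> conj_longest n p \<in> A"
  by (metis conj_longest_involution image_iff)

text \<open>Conjugation reverses both letters and positions, so a larger letter preceding a smaller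
  one is turned into another such pair, with the roles of the two letters exchanged. The bounds a
  \<le> n and b \<le> n keep the truncated subtractions exact.\<close>

lemma mem_value_inversions_conj:
  assumes p: "p permutes {1..n}"
  shows "(a, b) \<in> value_inversions n (conj_longest n p) \<longleftrightarrow>
    a \<le> n \<and> b \<le> n \<and> (n + 1 - b, n + 1 - a) \<in> value_inversions n p"
proof (cases "1 \<le> a \<and> a < b \<and> b \<le> n")
  case True
  let ?w = "longest_perm n"
  have inv: "inv (conj_longest n p) = ?w \<circ> inv p \<circ> ?w"
    unfolding conj_longest_def
    by (rule inv_unique_comp) (simp_all add: fun_eq_iff permutes_inverses[OF p])
  have "inv p (n + 1 - a) \<in> {1..n}" "inv p (n + 1 - b) \<in> {1..n}"
    using permutes_in_image[OF permutes_inv[OF p], of "n + 1 - a"]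
      permutes_in_image[OF permutes_inv[OF p], of "n + 1 - b"] True by auto
  moreover have "n + 1 - x < n + 1 - y \<longleftrightarrow> y < x" if "x \<in> {1..n}" "y \<in> {1..n}" for x y
    using that by auto
  moreover have "1 \<le> n + 1 - b" "n + 1 - a \<le> n" using True by auto
  ultimately show ?thesis using True by (simp add: mem_value_inversions inv longest_perm_def)
qed (auto simp: mem_value_inversions)

lemma value_inversions_conj_mono_iff:
  assumes p: "p permutes {1..n}" and q: "q permutes {1..n}"
  shows "value_inversions n (conj_longest n p) \<subseteq> value_inversions n (conj_longest n q) \<longleftrightarrow>
    value_inversions n p \<subseteq> value_inversions n q"
proof -
  have mono: "value_inversions n (conj_longest n r) \<subseteq> value_inversions n (conj_longest n s)"
    if "r permutes {1..n}" "s permutes {1..n}" "value_inversions n r \<subseteq> value_inversions n s" for r s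
    using that(3) by (auto simp: mem_value_inversions_conj[OF that(1)] mem_value_inversions_conj[OF that(2)])
  show ?thesis
    using mono[OF p q] mono[OF conj_longest_permutes[OF p] conj_longest_permutes[OF q]] by auto
qed

text \<open>The reflection maps the staircase onto itself, so it preserves the empty and the full
  inversion set.\<close>

lemma conj_longest_eq_of_extreme:
  assumes p: "p permutes {1..n}"
    and "value_inversions n p = {} \<or> value_inversions n p = shifted_staircase n"
  shows "conj_longest n p = p"
proof -
  have "a \<le> n \<and> b \<le> n \<and> 1 \<le> n + 1 - b \<and> n + 1 - b < n + 1 - a \<and> n + 1 - a \<le> n \<longleftrightarrow>
    1 \<le> a \<and> a < b \<and> b \<le> n" for a b
    by arith
  then have "(a, b) \<in> value_inversions n (conj_longest n p) \<longleftrightarrow> (a, b) \<in> value_inversions n p" for a b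
    using assms(2) unfolding mem_value_inversions_conj[OF p] by (metis empty_iff mem_shifted_staircase)
  then show ?thesis
    by (intro value_inversions_inject[OF conj_longest_permutes[OF p] p]) auto
qed

section \<open>Comparing the two sides\<close>

text \<open>The box (n - 1, n) is the greatest element of the staircase.\<close>

lemma staircase_ideal_corner:
  assumes "staircase_ideal n S" and "(n - 1, n) \<in> S"
  shows "S = shifted_staircase n"
proof -
  have "b \<in> S" if "b \<in> shifted_staircase n" for b
  proof -
    obtain i j where b: "b = (i, j)" by fastforce
    have "i \<le> n - 1" "j \<le> n" using that unfolding b mem_shifted_staircase by auto
    then show ?thesis using assms that unfolding staircase_ideal_def b by blast
  qed
  then show ?thesis using assms unfolding staircase_ideal_def by blast
qed

text \<open>The box (1, 2) is the least element of the staircase.\<close>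

lemma staircase_ideal_first:
  assumes "staircase_ideal n S" and "S \<noteq> {}"
  shows "(1, 2) \<in> S"
proof -
  obtain i j where ij: "(i, j) \<in> S" using assms(2) by fastforce
  then have "(i, j) \<in> shifted_staircase n" using assms unfolding staircase_ideal_def by blast
  then have "(1, 2) \<in> shifted_staircase n" "1 \<le> i" "2 \<le> j" by (auto simp: mem_shifted_staircase)
  then show ?thesis using ij assms unfolding staircase_ideal_def by blast
qed

(* A nonempty ideal contains (1, 2), and only the full ideal contains (n - 1, n); the reflection
   exchanges these two boxes. *)
lemma mixed_value_inversions:
  assumes p: "p \<in> left_unimodal_perms n" and q: "conj_longest n q \<in> left_unimodal_perms n"
  shows "value_inversions n p \<subseteq> value_inversions n q \<Longrightarrow> conj_longest n p = p \<or> conj_longest n q = q"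
    and "value_inversions n q \<subseteq> value_inversions n p \<Longrightarrow> conj_longest n p = p \<or> conj_longest n q = q"
proof -
  let ?q = "conj_longest n q"
  have pp: "p permutes {1..n}" using left_unimodal_permutes[OF p] .
  have qq: "?q permutes {1..n}" using left_unimodal_permutes[OF q] .
  note ip = staircase_ideal_value_inversions[OF p] and iq = staircase_ideal_value_inversions[OF q]
  have mem: "(a, b) \<in> value_inversions n q \<longleftrightarrow> a \<le> n \<and> b \<le> n \<and> (n + 1 - b, n + 1 - a) \<in> value_inversions n ?q" for a b
    using mem_value_inversions_conj[OF qq] by simp
  have fix_q: "?q = q" if "value_inversions n ?q = {} \<or> value_inversions n ?q = shifted_staircase n"
    using conj_longest_eq_of_extreme[OF qq that] by simp
  show "conj_longest n p = p \<or> ?q = q" if sub: "value_inversions n p \<subseteq> value_inversions n q"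
  proof (cases "value_inversions n p = {}")
    case False
    then have "(1, 2) \<in> value_inversions n q" using staircase_ideal_first[OF ip] sub by blast
    then have "(n - 1, n) \<in> value_inversions n ?q" using mem[of 1 2] by simp
    then show ?thesis using staircase_ideal_corner[OF iq] fix_q by blast
  qed (use conj_longest_eq_of_extreme[OF pp] in blast)
  show "conj_longest n p = p \<or> ?q = q" if sub: "value_inversions n q \<subseteq> value_inversions n p"
  proof (cases "value_inversions n ?q = {}")
    case False
    then have "(1, 2) \<in> value_inversions n ?q" using staircase_ideal_first[OF iq] by blast
    \<comment> \<open>With this bound n - 1 is not truncated, so the reflection of (n - 1, n) is
      indeed (1, 2).\<close>
    moreover from this have "2 \<le> n" by (simp add: mem_value_inversions)
    ultimately have "(n - 1, n) \<in> value_inversions n q"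
      using mem[of "n - 1" n] by (simp add: numeral_2_eq_2)
    then have "(n - 1, n) \<in> value_inversions n p" using sub by blast
    then show ?thesis using staircase_ideal_corner[OF ip] conj_longest_eq_of_extreme[OF pp] by blast
  qed (use fix_q in blast)
qed

text \<open>The longest permutation exchanges the prefix of j positions with the suffix of j
  positions and maps intervals inside {1..n} to intervals.\<close>

lemma unimodal_cases:
  assumes "p \<in> unimodal_perms n"
  shows "p \<in> left_unimodal_perms n \<or> conj_longest n p \<in> left_unimodal_perms n"
proof (cases "p \<in> left_unimodal_perms n")
  case False
  have p: "p permutes {1..n}" using assms by (simp add: unimodal_perms_def)
  have suffix: "\<exists>a b. p ` {j..n} = {a..b}" if "j \<in> {1..n}" for j
    using assms False that unfolding unimodal_perms_def left_unimodal_perms_def by blast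
  have "\<exists>a b. conj_longest n p ` {1..j} = {a..b}" if j: "j \<in> {1..n}" for j
  proof -
    let ?w = "longest_perm n"
    have w: "?w ` {x..y} = {n + 1 - y..n + 1 - x}" if "1 \<le> x" "y \<le> n" for x y
    proof
      show "?w ` {x..y} \<subseteq> {n + 1 - y..n + 1 - x}" using that by (auto simp: longest_perm_def)
      show "{n + 1 - y..n + 1 - x} \<subseteq> ?w ` {x..y}"
      proof (rule subsetI)
        fix z assume "z \<in> {n + 1 - y..n + 1 - x}"
        then have "?w z \<in> {x..y}" using that by (auto simp: longest_perm_def)
        then show "z \<in> ?w ` {x..y}" by (intro image_eqI[of _ _ "?w z"]) auto
      qed
    qed
    have "n + 1 - j \<in> {1..n}" using j by auto
    then obtain a b where ab: "p ` {n + 1 - j..n} = {a..b}" using suffix by blast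
    \<comment> \<open>The interval {a..b} is nonempty because it contains \<open>p n\<close>; only
      then does its inclusion in {1..n} bound the endpoints a and b.\<close>
    have "{n + 1 - j..n} \<subseteq> {1..n}" "n \<in> {n + 1 - j..n}" using j by auto
    then have "{a..b} \<subseteq> {1..n}" "p n \<in> {a..b}"
      using ab permutes_image[OF p] by blast+
    then have r: "1 \<le> a" "b \<le> n" by auto
    have "conj_longest n p ` {1..j} = ?w ` (p ` (?w ` {1..j}))"
      by (simp add: conj_longest_def image_comp)
    also have "\<dots> = {n + 1 - b..n + 1 - a}" using j w[of 1 j] w[OF r] ab by simp
    finally show ?thesis by blast
  qed
  then show ?thesis using conj_longest_permutes[OF p] by (simp add: left_unimodal_perms_def)
qed simp

section \<open>Shape on both sides and the weak order\<close>

lemma shape_eq: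
  "p \<in> left_unimodal_perms n \<Longrightarrow> shape n p = value_inversions n p"
  by (simp add: shape_def left_shape_eq)

text \<open>If \<open>p\<close> lies on both sides, the definition of \<open>shape\<close> takes its
  first branch. Comparing \<open>p\<close> with itself in \<open>mixed_value_inversions\<close>
  shows that \<open>p\<close> is fixed by the conjugation, so both branches agree.\<close>

lemma shape_eq_conj:
  assumes "conj_longest n p \<in> left_unimodal_perms n"
  shows "shape n p = value_inversions n (conj_longest n p)"
proof (cases "p \<in> left_unimodal_perms n")
  case True
  then show ?thesis using mixed_value_inversions(1)[OF True assms order_refl] by (auto simp: shape_eq)
qed (simp add: shape_def left_shape_eq[OF assms])

theorem theorem5p1:
  fixes n :: nat and \<pi> \<tau> :: "nat \<Rightarrow> nat"
  assumes "\<pi> \<in> unimodal_perms n" and "\<tau> \<in> unimodal_perms n"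
  shows "weak_le n \<pi> \<tau> \<longleftrightarrow>
     ((\<pi> \<in> left_unimodal_perms n \<and> \<tau> \<in> left_unimodal_perms n) \<or>
      (\<pi> \<in> conj_longest n ` left_unimodal_perms n \<and> \<tau> \<in> conj_longest n ` left_unimodal_perms n)) \<and>
     shape n \<pi> \<subseteq> shape n \<tau>"
proof -
  have perm: "\<pi> permutes {1..n}" "\<tau> permutes {1..n}"
    using assms by (auto simp: unimodal_perms_def)
  let ?L = "left_unimodal_perms n" and ?c = "conj_longest n"
  have left: "weak_le n \<pi> \<tau> \<longleftrightarrow> shape n \<pi> \<subseteq> shape n \<tau>" if "\<pi> \<in> ?L" "\<tau> \<in> ?L"
    using that weak_le_iff_value_inversions[OF perm] by (simp add: shape_eq)
  have right: "weak_le n \<pi> \<tau> \<longleftrightarrow> shape n \<pi> \<subseteq> shape n \<tau>" if "?c \<pi> \<in> ?L" "?c \<tau> \<in> ?L"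
    using that weak_le_iff_value_inversions[OF perm] value_inversions_conj_mono_iff[OF perm]
    by (simp add: shape_eq_conj)
  \<comment> \<open>If the two permutations come from different sides, one of them is fixed by the
    conjugation and so lies on both sides. The two parts of \<open>mixed_value_inversions\<close>
    handle \<open>\<pi>\<close> left with \<open>\<tau>\<close> right, and the reverse.\<close>
  have mixed: "(\<pi> \<in> ?L \<and> \<tau> \<in> ?L) \<or> (?c \<pi> \<in> ?L \<and> ?c \<tau> \<in> ?L)" if "weak_le n \<pi> \<tau>"
  proof -
    have sub: "value_inversions n \<pi> \<subseteq> value_inversions n \<tau>"
      using that weak_le_iff_value_inversions[OF perm] by simp
    show ?thesis
      using unimodal_cases[OF assms(1)] unimodal_cases[OF assms(2)]
        mixed_value_inversions(1)[of \<pi> n \<tau>] mixed_value_inversions(2)[of \<tau> n \<pi>] sub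
      by metis
  qed
  show ?thesis unfolding mem_conj_longest_image using left right mixed by blast
qed

end
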